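(* For each $\alpha>0$ there is a constant $c=c(\alpha)$ such that if $D$ is a digraph on the vertex set $[n]$ with all in-degrees and out-degrees at least $\alpha n$, and $R$ is a random digraph with distribution $\mathbb{D}(n,cn)$, then $D\cup R$ is a.a.s. pancyclic.
   Context: $[n]=\{1,\dots,n\}$. Digraphs have no loops and no repeated arcs but may contain 2-cycles, so there are $2\binom n2$ possible arcs on $[n]$. $\mathbb{D}(n,m)$ denotes the uniform distribution on digraphs with vertex set $[n]$ and exactly $m$ arcs. $D\cup R$ is the digraph on $[n]$ whose arc set is the union of the two arc sets. An $n$-vertex digraph is pancyclic if it contains (simple, directed) cycles of all lengths ranging from $3$ to $n$. A.a.s. means with probability $1-o(1)$ as $n\to\infty$, for any sequence of digraphs $D=D_n$ satisfying the hypotheses, with $\alpha$ fixed. Large quantities such as $cn$ are implicitly rounded to integers. *)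

theory Defs
  imports "HOL-Probability.Probability" "Graph_Theory.Graph_Theory"
begin

definition digraphs_on :: "nat \<Rightarrow> nat pair_pre_digraph set" where
  "digraphs_on n = {G. pair_digraph G \<and> pverts G = {1..n}}"

(* Only meaningful for m \<le> n * (n - 1): for larger m there are no such digraphs,
   and pmf_of_set {} is an unspecified distribution. *)
definition random_digraph :: "nat \<Rightarrow> nat \<Rightarrow> nat pair_pre_digraph pmf" where
  "random_digraph n m = pmf_of_set {G \<in> digraphs_on n. card (parcs G) = m}"

definition pancyclic :: "('a, 'b) pre_digraph \<Rightarrow> bool" where
  "pancyclic G \<longleftrightarrow> (\<forall>k\<in>{3..card (verts G)}. \<exists>p. pre_digraph.cycle G p \<and> length p = k)"

lemma digraphs_on_iff:
  "G \<in> digraphs_on n \<longleftrightarrow> pverts G = {1..n} \<and> parcs G \<subseteq> ({1..n} \<times> {1..n}) - Id"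
proof
  assume "G \<in> digraphs_on n"
  then have G: "pair_digraph G" "pverts G = {1..n}"
    by (auto simp: digraphs_on_def)
  interpret pair_digraph G by (rule G(1))
  show "pverts G = {1..n} \<and> parcs G \<subseteq> ({1..n} \<times> {1..n}) - Id"
    using G(2) arc_fst_in_verts arc_snd_in_verts pair_no_loops by fastforce
next
  assume G: "pverts G = {1..n} \<and> parcs G \<subseteq> ({1..n} \<times> {1..n}) - Id"
  then have "finite (parcs G)"
    using finite_subset[of "parcs G" "({1..n} \<times> {1..n}) - Id"] by blast
  with G have "pair_digraph G"
    by unfold_locales auto
  with G show "G \<in> digraphs_on n"
    by (simp add: digraphs_on_def)
qed

lemma finite_digraphs_on: "finite (digraphs_on n)"
proof (rule finite_subset)
  show "digraphs_on n \<subseteq>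
      (\<lambda>A. \<lparr>pverts = {1..n}, parcs = A\<rparr>) ` Pow (({1..n} \<times> {1..n}) - Id)"
  proof
    fix G assume "G \<in> digraphs_on n"
    then have "G = \<lparr>pverts = {1..n}, parcs = parcs G\<rparr>"
      and "parcs G \<in> Pow (({1..n} \<times> {1..n}) - Id)"
      by (auto simp: digraphs_on_iff)
    then show "G \<in> (\<lambda>A. \<lparr>pverts = {1..n}, parcs = A\<rparr>) ` Pow (({1..n} \<times> {1..n}) - Id)"
      by (rule image_eqI)
  qed
qed simp

lemma digraphs_on_card_nonempty:
  assumes "m \<le> n * (n - 1)"
  shows "{G \<in> digraphs_on n. card (parcs G) = m} \<noteq> {}"
proof -
  have eq: "({1..n} \<times> {1..n}) - Id = ({1..n} \<times> {1..n}) - (\<lambda>i. (i, i)) ` {1..n}"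
    by auto
  have "card (({1..n} \<times> {1..n}) - Id) = n * n - n"
    unfolding eq by (subst card_Diff_subset) (auto simp: card_image inj_on_def)
  with assms obtain A where "A \<subseteq> ({1..n} \<times> {1..n}) - Id" "card A = m"
    using obtain_subset_with_card_n[of m "({1..n} \<times> {1..n}) - Id"]
    by (auto simp: diff_mult_distrib2)
  then have "\<lparr>pverts = {1..n}, parcs = A\<rparr> \<in> {G \<in> digraphs_on n. card (parcs G) = m}"
    by (simp add: digraphs_on_iff)
  then show ?thesis by blast
qed

end

theory Submission
  imports Defs "HOL-Real_Asymp.Real_Asymp"
begin

text \<open>
  With \<open>m\<close> a small multiple of \<open>\<alpha> n\<close>, a union bound over \<open>4\<^sup>n\<close> pairs shows that a.a.s. \<open>R\<close> has an
  arc from \<open>A\<close> to \<open>B\<close> whenever \<open>A\<close> and \<open>B\<close> have at least \<open>m\<close> vertices each. The rest is deterministic.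
  Fix a vertex \<open>s\<close>, disjoint sets \<open>A\<close> of out-neighbours and \<open>B\<close> of in-neighbours of \<open>s\<close> in \<open>D\<close>, each of
  size \<open>m\<close>, and a path through all but \<open>O(m)\<close> of the remaining vertices. Almost every vertex of
  the path receives an arc from \<open>A\<close>, and almost every one sends an arc to \<open>B\<close>, so some subpath
  of each prescribed length can be closed through \<open>A\<close>, \<open>s\<close> and \<open>B\<close>. This gives cycles of all lengths
  up to \<open>n - 6m\<close>. A longer cycle can absorb any outside vertex \<open>w\<close>: since \<open>w\<close> has many in- and
  out-neighbours on the cycle, there is a rearrangement of three segments, two of whose new arcs come from \<open>R\<close>,
  that makes room for \<open>w\<close>.
\<close>

subsection \<open>Paths and cycles in joined digraphs\<close>

definition dipath :: "('a \<times> 'a) set \<Rightarrow> 'a list \<Rightarrow> bool" where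
  "dipath E xs \<longleftrightarrow> distinct xs \<and> successively (\<lambda>x y. (x, y) \<in> E) xs"

definition dicycle :: "('a \<times> 'a) set \<Rightarrow> 'a list \<Rightarrow> bool" where
  "dicycle E xs \<longleftrightarrow> xs \<noteq> [] \<and> dipath E xs \<and> (last xs, hd xs) \<in> E"

text \<open>\<open>A\<close> and \<open>B\<close> may overlap or coincide. The property fails for
  \<open>m = 0\<close>, since empty sets span no arc; this is the source of \<open>m > 0\<close> in
  the proofs.\<close>

definition joined :: "('a \<times> 'a) set \<Rightarrow> 'a set \<Rightarrow> nat \<Rightarrow> bool" where
  "joined E V m \<longleftrightarrow>
     (\<forall>A B. A \<subseteq> V \<longrightarrow> B \<subseteq> V \<longrightarrow> m \<le> card A \<longrightarrow> m \<le> card B \<longrightarrow> (\<exists>a\<in>A. \<exists>b\<in>B. (a, b) \<in> E))"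

lemma joinedD:
  assumes "joined E V m" "A \<subseteq> V" "B \<subseteq> V" "m \<le> card A" "m \<le> card B"
  obtains a b where "a \<in> A" "b \<in> B" "(a, b) \<in> E"
  using assms unfolding joined_def by meson

lemma joined_mono:
  assumes "joined E V m" "E \<subseteq> F"
  shows "joined F V m"
  using assms unfolding joined_def by (meson subsetD)

text \<open>The exceptional vertices form a set with no arc from (respectively to) \<open>A\<close>,
  so \<open>m\<close> of them would contradict joinedness.\<close>

lemma card_not_dominated_less:
  assumes "joined E V m" "finite V" "A \<subseteq> V" "m \<le> card A"
  shows "card {x\<in>V. \<not> (\<exists>a\<in>A. (a, x) \<in> E)} < m"
    and "card {x\<in>V. \<not> (\<exists>a\<in>A. (x, a) \<in> E)} < m"
proof -
  show "card {x\<in>V. \<not> (\<exists>a\<in>A. (a, x) \<in> E)} < m"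
  proof (rule ccontr)
    assume "\<not> ?thesis"
    then obtain a b where "a \<in> A" "b \<in> {x\<in>V. \<not> (\<exists>a\<in>A. (a, x) \<in> E)}" "(a, b) \<in> E"
      using joinedD[OF assms(1,3) _ assms(4), of "{x\<in>V. \<not> (\<exists>a\<in>A. (a, x) \<in> E)}"] by (auto simp: not_less)
    then show False by blast
  qed
  show "card {x\<in>V. \<not> (\<exists>a\<in>A. (x, a) \<in> E)} < m"
  proof (rule ccontr)
    assume "\<not> ?thesis"
    then obtain a b where "b \<in> A" "a \<in> {x\<in>V. \<not> (\<exists>a\<in>A. (x, a) \<in> E)}" "(a, b) \<in> E"
      using joinedD[OF assms(1) _ assms(3) _ assms(4), of "{x\<in>V. \<not> (\<exists>a\<in>A. (x, a) \<in> E)}"] by (auto simp: not_less)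
    then show False by blast
  qed
qed

text \<open>Turns a bound on bad vertices into a bound on bad positions of a list; \<open>f\<close>
  will be the identity or a shift.\<close>

lemma card_Collect_nth_le:
  assumes "finite V" "set xs \<subseteq> V" "distinct xs"
    and len: "\<And>i. i \<in> I \<Longrightarrow> f i < length xs" and f: "inj_on f I"
  shows "card {i\<in>I. Q (xs ! f i)} \<le> card {x\<in>V. Q x}"
proof (rule card_inj_on_le)
  show "inj_on (\<lambda>i. xs ! f i) {i\<in>I. Q (xs ! f i)}"
    using assms by (auto simp: inj_on_def nth_eq_iff_index_eq)
  show "(\<lambda>i. xs ! f i) ` {i\<in>I. Q (xs ! f i)} \<subseteq> {x\<in>V. Q x}"
    using assms by (auto dest: nth_mem)
qed (use assms in auto)

text \<open>Pigeonhole: there are at least \<open>2 * m\<close> starting positions, fewer than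
  \<open>m\<close> of which violate \<open>P\<close>, and fewer than \<open>m\<close> of which
  violate \<open>Q\<close> after the shift by \<open>d\<close>.\<close>

lemma window_exists:
  assumes "finite V" "set xs \<subseteq> V" "distinct xs"
    and P: "card {x\<in>V. \<not> P x} < m" and Q: "card {x\<in>V. \<not> Q x} < m"
    and len: "d + 2 * m \<le> length xs"
  obtains i where "i + d < length xs" "P (xs ! i)" "Q (xs ! (i + d))"
proof -
  let ?I = "{..<length xs - d}"
  have "card {i\<in>?I. \<not> P (xs ! i)} < m"
    using card_Collect_nth_le[OF assms(1-3), of ?I "\<lambda>i. i" "\<lambda>x. \<not> P x"] P
    by (simp add: less_diff_conv)
  moreover have "card {i\<in>?I. \<not> Q (xs ! (i + d))} < m"
    using card_Collect_nth_le[OF assms(1-3), of ?I "\<lambda>i. i + d" "\<lambda>x. \<not> Q x"] Q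
    by (simp add: less_diff_conv)
  ultimately have "card ({i\<in>?I. \<not> P (xs ! i)} \<union> {i\<in>?I. \<not> Q (xs ! (i + d))}) < card ?I"
    using len by (intro le_less_trans[OF card_Un_le]) simp
  then have "\<not> ?I \<subseteq> {i\<in>?I. \<not> P (xs ! i)} \<union> {i\<in>?I. \<not> Q (xs ! (i + d))}"
    using card_mono[of "{i\<in>?I. \<not> P (xs ! i)} \<union> {i\<in>?I. \<not> Q (xs ! (i + d))}" ?I] by auto
  then show thesis using that by (auto simp: less_diff_conv)
qed

text \<open>Depth-first search: \<open>S\<close> holds the exhausted vertices, \<open>p\<close> is the current path and \<open>U\<close> is
  unexplored. A state minimising \<open>\<mu>\<close> is one in which the next backtracking step would make \<open>S\<close>
  of size \<open>m\<close>; as no arc leads from \<open>S\<close> to \<open>U\<close>, then \<open>U\<close> is small as well and the path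
  contains nearly everything.\<close>

lemma long_dipath_exists:
  assumes "finite V" "joined E V m" "W \<subseteq> V"
  obtains p where "dipath E p" "set p \<subseteq> W" "card W < length p + 2 * m"
proof -
  define state where "state = (\<lambda>(S, p, U). S \<union> set p \<union> U = W \<and> S \<inter> set p = {} \<and> S \<inter> U = {} \<and>
    set p \<inter> U = {} \<and> dipath E p \<and> (\<forall>x\<in>S. \<forall>y\<in>U. (x, y) \<notin> E) \<and> card S < m)"
  \<comment> \<open>The factor 2 makes both search moves decrease the measure by one: extending the
    path takes a vertex out of \<open>U\<close> but lengthens \<open>p\<close>, while backtracking
    shortens \<open>p\<close> and leaves \<open>U\<close> alone.\<close>
  define \<mu> where "\<mu> = (\<lambda>(S :: 'a set, p :: 'a list, U :: 'a set). 2 * card U + length p)"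
  have finW: "finite W" using assms finite_subset by blast
  have "m > 0" using assms(2) by (cases m) (auto simp: joined_def)
  then have "state ({}, [], W)" by (auto simp: state_def dipath_def)
  then obtain s where s: "state s" "\<And>t. state t \<Longrightarrow> \<mu> s \<le> \<mu> t"
    using ex_has_least_nat[of state _ \<mu>] by blast
  obtain S p U where spu: "s = (S, p, U)" by (cases s)
  have W: "S \<union> set p \<union> U = W" "S \<inter> set p = {}" "S \<inter> U = {}" "set p \<inter> U = {}" and p: "dipath E p"
    and SU: "\<forall>x\<in>S. \<forall>y\<in>U. (x, y) \<notin> E" and S: "card S < m"
    using s(1) by (auto simp: state_def spu)
  have fin: "finite S" "finite U" using W(1) finW by auto
  have stuck: "(last p, u) \<notin> E" if "u \<in> U" "p \<noteq> []" for u
  proof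
    assume "(last p, u) \<in> E"
    then have "state (S, p @ [u], U - {u})"
      using W p SU S that by (auto simp: state_def dipath_def successively_append_iff)
    from s(2)[OF this] show False
      using that fin card_Suc_Diff1[of U u] by (simp add: \<mu>_def spu)
  qed
  have "card U < m"
  proof (rule ccontr)
    assume U: "\<not> card U < m"
    show False
    proof (cases "p = []")
      case True
      obtain u where u: "u \<in> U" using U \<open>m > 0\<close> by (cases "U = {}") auto
      then have "state (S, [u], U - {u})"
        using W SU S True by (auto simp: state_def dipath_def)
      from s(2)[OF this] show False
        using u fin card_Suc_Diff1[of U u] True by (simp add: \<mu>_def spu)
    next
      case False
      then obtain q v where q: "p = q @ [v]" by (metis rev_exhaust)
      have v: "v \<notin> S" using W(2) q by auto
      have *: "\<forall>x\<in>insert v S. \<forall>y\<in>U. (x, y) \<notin> E"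
        using SU stuck q by auto
      show False
      proof (cases "card (insert v S) < m")
        case True
        then have "state (insert v S, q, U)"
          using W p * q by (auto simp: state_def dipath_def successively_append_iff)
        from s(2)[OF this] show False by (simp add: \<mu>_def spu q)
      next
        case False
        then have "m \<le> card (insert v S)" "m \<le> card U" using U by auto
        moreover have "insert v S \<subseteq> V" "U \<subseteq> V" using W(1) assms(3) q by auto
        ultimately obtain a b where "a \<in> insert v S" "b \<in> U" "(a, b) \<in> E"
          using joinedD[OF assms(2)] by metis
        then show False using * by blast
      qed
    qed
  qed
  moreover have "card W = card S + length p + card U"
  proof -
    have "card W = card (S \<union> set p) + card U"
      unfolding W(1)[symmetric] using W fin by (intro card_Un_disjoint) auto
    also have "card (S \<union> set p) = card S + length p"
      using W fin p by (subst card_Un_disjoint) (auto simp: dipath_def distinct_card)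
    finally show ?thesis .
  qed
  ultimately show thesis using that[of p] S p W(1) by auto
qed

section \<open>Cycles of length at most \<open>card V - 6 * m\<close>\<close>

lemma dipath_take_drop:
  assumes "dipath E p"
  shows "dipath E (take i p)" "dipath E (drop i p)"
proof -
  have "dipath E (take i p @ drop i p)" using assms by simp
  then show "dipath E (take i p)" "dipath E (drop i p)"
    unfolding dipath_def successively_append_iff by auto
qed

text \<open>The cycle runs through \<open>s\<close>, some \<open>a\<close> in \<open>A\<close>, a
  window of a long path, and some \<open>b\<close> in \<open>B\<close>. The slack
  \<open>6 * m\<close> is spent in three equal shares: on removing \<open>A\<close> and
  \<open>B\<close>, on the vertices missed by the path, and on finding the window.\<close>

lemma short_dicycle_exists:
  assumes "finite V" "joined E V m" "s \<in> V" "irrefl E"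
    and X: "X \<subseteq> V" "2 * m \<le> card X" "\<And>x. x \<in> X \<Longrightarrow> (s, x) \<in> E"
    and Y: "Y \<subseteq> V" "2 * m \<le> card Y" "\<And>y. y \<in> Y \<Longrightarrow> (y, s) \<in> E"
    and k: "3 \<le> k" "k + 6 * m \<le> card V"
  obtains xs where "dicycle E xs" "set xs \<subseteq> V" "length xs = k"
proof -
  have noloop: "(x, x) \<notin> E" for x using assms(4) by (simp add: irrefl_def)
  have finX: "finite X" "finite Y" using X Y assms(1) finite_subset by blast+
  obtain A where A: "A \<subseteq> X" "card A = m"
    using X(2) obtain_subset_with_card_n[of m X] by auto
  \<comment> \<open>Out- and in-neighbours of \<open>s\<close> may coincide, so \<open>A\<close> can
    use up \<open>m\<close> vertices of \<open>Y\<close>.\<close>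
  have "m \<le> card (Y - A)"
    using Y(2) A diff_card_le_card_Diff[of A Y] finite_subset[OF A(1) finX(1)] by simp
  then obtain B where B: "B \<subseteq> Y - A" "card B = m"
    using obtain_subset_with_card_n[of m "Y - A"] by metis
  have AV: "A \<subseteq> V" "B \<subseteq> V" using A B X Y by auto
  have sAB: "s \<notin> A" "s \<notin> B" using A B X(3) Y(3) noloop by blast+
  show thesis
  \<comment> \<open>Here the window would be empty, so an arc from \<open>A\<close> to
    \<open>B\<close> closes the triangle directly.\<close>
  proof (cases "k = 3")
    case True
    obtain a b where ab: "a \<in> A" "b \<in> B" "(a, b) \<in> E"
      using joinedD[OF assms(2) AV] A B by auto
    then have "dicycle E [s, a, b]"
      using A B X(3) Y(3) sAB by (auto simp: dicycle_def dipath_def)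
    then show thesis using that[of "[s, a, b]"] ab AV assms(3) True by auto
  next
    case False
    define W where "W = V - insert s (A \<union> B)"
    obtain p where p: "dipath E p" "set p \<subseteq> W" "card W < length p + 2 * m"
      using long_dipath_exists[OF assms(1,2), of W] by (auto simp: W_def)
    have "card (insert s (A \<union> B)) \<le> Suc (m + m)"
      using A B finX card_Un_le[of A B] finite_subset
      by (intro order.trans[OF card_insert_le_m1[OF zero_less_Suc]]) auto
    moreover have "card W \<ge> card V - card (insert s (A \<union> B))"
      unfolding W_def using AV assms(1) finite_subset by (intro diff_card_le_card_Diff) blast
    ultimately have "card V \<le> card W + Suc (2 * m)" by linarith
    \<comment> \<open>Besides \<open>s\<close>, \<open>a\<close> and \<open>b\<close> the cycle
      needs \<open>k - 3\<close> path vertices, whose ends are \<open>k - 4\<close> positions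
      apart.\<close>
    then have "(k - 4) + 2 * m \<le> length p" using p(3) k False by linarith
    moreover have "set p \<subseteq> V" "distinct p" using p W_def dipath_def by auto
    moreover have "card {x\<in>V. \<not> (\<exists>a\<in>A. (a, x) \<in> E)} < m" "card {x\<in>V. \<not> (\<exists>b\<in>B. (x, b) \<in> E)} < m"
      using card_not_dominated_less[OF assms(2,1)] AV A B by auto
    ultimately obtain i where i: "i + (k - 4) < length p" "\<exists>a\<in>A. (a, p ! i) \<in> E"
        "\<exists>b\<in>B. (p ! (i + (k - 4)), b) \<in> E"
      by - (rule window_exists[OF assms(1), where xs = p and d = "k - 4" and m = m
          and P = "\<lambda>x. \<exists>a\<in>A. (a, x) \<in> E" and Q = "\<lambda>x. \<exists>b\<in>B. (x, b) \<in> E"])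
    then obtain a b where ab: "a \<in> A" "(a, p ! i) \<in> E" "b \<in> B" "(p ! (i + (k - 4)), b) \<in> E"
      by blast
    define q where "q = take (k - 3) (drop i p)"
    have lenq: "length q = k - 3" using i(1) k False by (simp add: q_def)
    have q: "q \<noteq> []" "hd q = p ! i" "last q = p ! (i + (k - 4))"
    proof -
      show "q \<noteq> []" using lenq k False by auto
      show "hd q = p ! i" using i(1) k False by (simp add: q_def hd_drop_conv_nth)
      have "last q = q ! (k - 4)" using \<open>q \<noteq> []\<close> lenq by (simp add: last_conv_nth)
      then show "last q = p ! (i + (k - 4))" using i(1) k False by (simp add: q_def)
    qed
    have qW: "set q \<subseteq> W" using p(2) set_take_subset set_drop_subset unfolding q_def by fast
    have dq: "dipath E q" unfolding q_def using p(1) by (intro dipath_take_drop)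
    have "dicycle E (s # a # q @ [b])"
      using ab q dq sAB A B X(3) Y(3) qW
      by (auto simp: dicycle_def dipath_def successively_append_iff successively_Cons W_def)
    moreover have "set (s # a # q @ [b]) \<subseteq> V"
      using qW AV ab assms(3) by (auto simp: W_def)
    ultimately show thesis using that[of "s # a # q @ [b]"] lenq k False by simp
  qed
qed

section \<open>Absorbing an outside vertex into a long cycle\<close>

lemma split_list_card_Int:
  assumes "distinct xs" "a \<le> card (X \<inter> set xs)"
  obtains ys zs where "xs = ys @ zs" "card (X \<inter> set ys) = a" "card (X \<inter> set zs) = card (X \<inter> set xs) - a"
proof -
  have "\<exists>ys zs. xs = ys @ zs \<and> card (X \<inter> set ys) = a"
    using assms
  proof (induction xs rule: rev_induct)
    case (snoc x xs)
    show ?case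
    proof (cases "a \<le> card (X \<inter> set xs)")
      case True
      then obtain ys zs where "xs = ys @ zs" "card (X \<inter> set ys) = a" using snoc by auto
      then show ?thesis by (metis append.assoc)
    next
      case False
      \<comment> \<open>Discrete continuity: one more vertex raises the count by at most one, so no
        value is skipped.\<close>
      have "card (X \<inter> set (xs @ [x])) \<le> Suc (card (X \<inter> set xs))"
        by (auto simp: Int_insert_right card_insert_if)
      then have "card (X \<inter> set (xs @ [x])) = a" using False snoc.prems by linarith
      then show ?thesis by (metis append_Nil2)
    qed
  qed simp
  then obtain ys zs where *: "xs = ys @ zs" "card (X \<inter> set ys) = a" by blast
  have "card (X \<inter> set xs) = card (X \<inter> set ys) + card (X \<inter> set zs)"
    using * assms(1) by (subst card_Un_disjoint[symmetric]) (auto simp: Int_Un_distrib)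
  with * that show thesis by simp
qed

lemma dicycle_rotate:
  assumes "dicycle E (ys @ zs)"
  shows "dicycle E (zs @ ys)"
  using assms by (cases "ys = []"; cases "zs = []")
    (auto simp: dicycle_def dipath_def successively_append_iff)

text \<open>The only reordering of three segments of a cycle that keeps all orientations.\<close>

lemma dicycle_exchange:
  assumes "dicycle E ((y1 @ y2) @ (a1 @ a2) @ (b1 @ b2))"
    and "y1 \<noteq> []" "y2 \<noteq> []" "a1 \<noteq> []" "a2 \<noteq> []" "b1 \<noteq> []" "b2 \<noteq> []"
    and "w \<notin> set ((y1 @ y2) @ (a1 @ a2) @ (b1 @ b2))"
    and "(last y1, w) \<in> E" "(w, hd a2) \<in> E" "(last b1, hd y2) \<in> E" "(last a1, hd b2) \<in> E"
  shows "dicycle E (y1 @ [w] @ a2 @ b1 @ y2 @ a1 @ b2)"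
  using assms by (auto simp: dicycle_def dipath_def successively_append_iff successively_Cons)

text \<open>Only the last entry lacks a successor and only the first lacks a predecessor, so passing
  to successors or predecessors loses at most one vertex. These neighbours are the places where a
  list can be cut next to a vertex of \<open>X\<close>.\<close>

lemma card_nth_neighbours:
  assumes "distinct xs"
  shows "card (X \<inter> set xs) \<le> Suc (card {xs ! Suc i |i. Suc i < length xs \<and> xs ! i \<in> X})"
    and "card (X \<inter> set xs) \<le> Suc (card {xs ! i |i. Suc i < length xs \<and> xs ! Suc i \<in> X})"
proof -
  let ?I = "{i. i < length xs \<and> xs ! i \<in> X}"
  have X: "X \<inter> set xs = (!) xs ` ?I" by (auto simp: in_set_conv_nth)
  have card_image_nth: "card ((\<lambda>i. xs ! f i) ` J) = card J"
    if "inj_on f J" "\<And>i. i \<in> J \<Longrightarrow> f i < length xs" for f J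
    using that assms by (intro card_image) (auto simp: inj_on_def nth_eq_iff_index_eq)
  have cX: "card (X \<inter> set xs) = card ?I"
    by (subst X, rule card_image_nth) auto
  let ?J = "{i. Suc i < length xs \<and> xs ! i \<in> X}"
  have finJ: "finite ?J" by (rule finite_subset[of _ "{..<length xs}"]) auto
  have "{xs ! Suc i |i. Suc i < length xs \<and> xs ! i \<in> X} = (\<lambda>i. xs ! Suc i) ` ?J" by auto
  also have "card \<dots> = card ?J" by (rule card_image_nth) auto
  finally have "card {xs ! Suc i |i. Suc i < length xs \<and> xs ! i \<in> X} = card ?J" .
  moreover have "card ?I \<le> card (insert (length xs - 1) ?J)"
    using finJ by (intro card_mono) auto
  ultimately show "card (X \<inter> set xs) \<le> Suc (card {xs ! Suc i |i. Suc i < length xs \<and> xs ! i \<in> X})"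
    using finJ cX by (simp add: card_insert_if split: if_splits)
  let ?K = "{i. Suc i < length xs \<and> xs ! Suc i \<in> X}"
  have finK: "finite ?K" by (rule finite_subset[of _ "{..<length xs}"]) auto
  have "{xs ! i |i. Suc i < length xs \<and> xs ! Suc i \<in> X} = (!) xs ` ?K" by auto
  also have "card \<dots> = card ?K" by (rule card_image_nth) auto
  finally have "card {xs ! i |i. Suc i < length xs \<and> xs ! Suc i \<in> X} = card ?K" .
  moreover have "?I \<subseteq> insert 0 (Suc ` ?K)"
  proof
    fix i assume "i \<in> ?I"
    then show "i \<in> insert 0 (Suc ` ?K)" by (cases i) auto
  qed
  then have "card ?I \<le> card (insert 0 (Suc ` ?K))"
    using finK by (intro card_mono) auto
  then have "card ?I \<le> Suc (card ?K)"
    using finK by (simp add: card_insert_if card_image)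
  ultimately show "card (X \<inter> set xs) \<le> Suc (card {xs ! i |i. Suc i < length xs \<and> xs ! Suc i \<in> X})"
    using cX by simp
qed

text \<open>Cut \<open>ys\<close> just after an in-neighbour of \<open>w\<close> and
  \<open>as\<close> just before an out-neighbour of \<open>w\<close>, so that \<open>w\<close> fits
  in between. Joinedness then supplies a cut of \<open>bs\<close> for which the other two new arcs
  of \<open>dicycle_exchange\<close> exist.\<close>

lemma dicycle_insert_separated:
  assumes "finite V" "joined E V m" and cyc: "dicycle E (ys @ zs)" "set (ys @ zs) \<subseteq> V"
    and w: "w \<notin> set (ys @ zs)"
    and X: "4 * m \<le> card (X \<inter> set ys)" "\<And>x. x \<in> X \<Longrightarrow> (x, w) \<in> E"
    and Y: "5 * m \<le> card (Y \<inter> set zs)" "\<And>y. y \<in> Y \<Longrightarrow> (w, y) \<in> E"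
  obtains xs where "dicycle E xs" "set xs = insert w (set (ys @ zs))"
proof -
  have "m > 0" using assms(2) by (cases m) (auto simp: joined_def)
  have dist: "distinct (ys @ zs)" using cyc(1) by (simp add: dicycle_def dipath_def)
  \<comment> \<open>\<open>2 * m\<close> out-neighbours suffice for choosing the cut of
    \<open>as\<close>; the other \<open>3 * m\<close> or more only ensure that \<open>bs\<close> is
    long.\<close>
  obtain as bs where zs: "zs = as @ bs" "card (Y \<inter> set as) = 2 * m"
      "card (Y \<inter> set bs) = card (Y \<inter> set zs) - 2 * m"
    using split_list_card_Int[of zs "2 * m" Y] dist Y(1) by auto
  have "card (Y \<inter> set bs) \<le> card (set bs)" by (intro card_mono) auto
  then have lenb: "3 * m \<le> length bs" using zs Y(1) dist by (simp add: distinct_card)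
  \<comment> \<open>\<open>X'\<close> collects the possible heads of \<open>y2\<close>, and
    \<open>Y'\<close> the possible ends of \<open>a1\<close>.\<close>
  define X' where "X' = {ys ! Suc i |i. Suc i < length ys \<and> ys ! i \<in> X}"
  define Y' where "Y' = {as ! i |i. Suc i < length as \<and> as ! Suc i \<in> Y}"
  have "m \<le> card X'" "m \<le> card Y'"
    using card_nth_neighbours(1)[of ys X] card_nth_neighbours(2)[of as Y] dist zs X(1) \<open>m > 0\<close>
    by (auto simp: X'_def Y'_def)
  moreover have "X' \<subseteq> V" "Y' \<subseteq> V"
    using cyc(2) zs(1) by (auto simp: X'_def Y'_def)
  ultimately have dom: "card {x\<in>V. \<not> (\<exists>x'\<in>X'. (x, x') \<in> E)} < m"
      "card {x\<in>V. \<not> (\<exists>y'\<in>Y'. (y', x) \<in> E)} < m"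
    using card_not_dominated_less[OF assms(2,1)] by blast+
  have "set bs \<subseteq> V" "distinct bs" using cyc(2) dist zs(1) by auto
  \<comment> \<open>A window with \<open>d = 1\<close> gives consecutive vertices of
    \<open>bs\<close>, the future \<open>last b1\<close> and \<open>hd b2\<close>; its length
    requirement \<open>2 * m + 1\<close> is at most \<open>3 * m\<close>.\<close>
  then obtain k where k: "k + 1 < length bs"
      "\<exists>x'\<in>X'. (bs ! k, x') \<in> E" "\<exists>y'\<in>Y'. (y', bs ! (k + 1)) \<in> E"
    using window_exists[OF assms(1) _ _ dom, of bs 1] lenb \<open>m > 0\<close> by auto
  then obtain i j where i: "Suc i < length ys" "ys ! i \<in> X" "(bs ! k, ys ! Suc i) \<in> E"
    and j: "Suc j < length as" "as ! Suc j \<in> Y" "(as ! j, bs ! (k + 1)) \<in> E"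
    unfolding X'_def Y'_def by blast
  define y1 y2 a1 a2 b1 b2 where "y1 = take (Suc i) ys" "y2 = drop (Suc i) ys"
    and "a1 = take (Suc j) as" "a2 = drop (Suc j) as" and "b1 = take (Suc k) bs" "b2 = drop (Suc k) bs"
  note defs = this
  have app: "ys = y1 @ y2" "as = a1 @ a2" "bs = b1 @ b2" by (simp_all add: defs)
  have "dicycle E (y1 @ [w] @ a2 @ b1 @ y2 @ a1 @ b2)"
  proof (rule dicycle_exchange)
    show "dicycle E ((y1 @ y2) @ (a1 @ a2) @ (b1 @ b2))"
      using cyc(1) unfolding zs(1) app by simp
    show "w \<notin> set ((y1 @ y2) @ (a1 @ a2) @ (b1 @ b2))"
      using w unfolding zs(1) app by simp
  qed (use i j k X(2) Y(2) in \<open>simp_all add: defs take_Suc_conv_app_nth hd_drop_conv_nth\<close>)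
  moreover have "set (y1 @ [w] @ a2 @ b1 @ y2 @ a1 @ b2) = insert w (set (ys @ zs))"
    unfolding zs(1) app by auto
  ultimately show thesis by (rule that)
qed

text \<open>Halving \<open>X\<close> along the cycle, one of the two halves leaves enough of \<open>Y\<close> in the other,
  and a rotation puts the half of \<open>X\<close> first.\<close>

lemma dicycle_insert:
  assumes "finite V" "joined E V m" and cyc: "dicycle E xs" "set xs \<subseteq> V" and w: "w \<notin> set xs"
    and X: "10 * m \<le> card (X \<inter> set xs)" "\<And>x. x \<in> X \<Longrightarrow> (x, w) \<in> E"
    and Y: "10 * m \<le> card (Y \<inter> set xs)" "\<And>y. y \<in> Y \<Longrightarrow> (w, y) \<in> E"
  obtains zs where "dicycle E zs" "set zs = insert w (set xs)"
proof -
  have dist: "distinct xs" using cyc(1) by (simp add: dicycle_def dipath_def)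
  obtain ys zs where xs: "xs = ys @ zs" "card (X \<inter> set ys) = 4 * m"
      "card (X \<inter> set zs) = card (X \<inter> set xs) - 4 * m"
    using split_list_card_Int[OF dist, of "4 * m" X] X(1) by auto
  have "card (Y \<inter> set xs) \<le> card (Y \<inter> set ys) + card (Y \<inter> set zs)"
    unfolding xs(1) set_append Int_Un_distrib by (rule card_Un_le)
  then consider "5 * m \<le> card (Y \<inter> set zs)" | "5 * m \<le> card (Y \<inter> set ys)"
    using Y(1) by linarith
  then show thesis
  proof cases
    case 1
    show thesis
    proof (rule dicycle_insert_separated[OF assms(1,2), of ys zs w X Y])
      show "4 * m \<le> card (X \<inter> set ys)" using xs(2) by simp
    qed (use 1 cyc w X(2) Y(2) that xs(1) in auto)
  next
    case 2
    have eq: "set (zs @ ys) = set xs" using xs(1) by auto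
    show thesis
    proof (rule dicycle_insert_separated[OF assms(1,2), of zs ys w X Y])
      show "dicycle E (zs @ ys)" using cyc(1) xs(1) dicycle_rotate by blast
      show "4 * m \<le> card (X \<inter> set zs)" using xs(3) X(1) by linarith
    qed (use 2 cyc(2) w X(2) Y(2) that in \<open>simp_all only: eq not_False_eq_True\<close>)
  qed
qed

text \<open>Lengths up to \<open>card V - 6 * m\<close> are obtained directly; each longer cycle
  arises from one that is shorter by one. The shorter cycle misses at most \<open>6 * m\<close>
  vertices, so of \<open>16 * m\<close> neighbours at least \<open>10 * m\<close> lie on it.\<close>

lemma dicycle_all_lengths:
  assumes "finite V" "joined E V m" "irrefl E"
    and outdeg: "\<And>v. v \<in> V \<Longrightarrow> 16 * m \<le> card {u\<in>V. (v, u) \<in> E}"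
    and indeg: "\<And>v. v \<in> V \<Longrightarrow> 16 * m \<le> card {u\<in>V. (u, v) \<in> E}"
    and k: "3 \<le> k" "k \<le> card V"
  shows "\<exists>xs. dicycle E xs \<and> set xs \<subseteq> V \<and> length xs = k"
proof -
  obtain s where s: "s \<in> V" using k by (cases "V = {}") auto
  have noloop: "(x, x) \<notin> E" for x using assms(3) by (simp add: irrefl_def)
  have m: "16 * m < card V"
  proof -
    have "{u\<in>V. (s, u) \<in> E} \<subset> V" using s noloop by blast
    from psubset_card_mono[OF assms(1) this] show ?thesis using outdeg[OF s] by linarith
  qed
  have "m > 0" using assms(2) by (cases m) (auto simp: joined_def)
  show ?thesis using k
  proof (induction k rule: nat_less_induct)
    case (1 k)
    show ?case
    proof (cases "k + 6 * m \<le> card V")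
      case True
      show ?thesis
        by (rule short_dicycle_exists[OF assms(1,2) s assms(3), of "{u\<in>V. (s, u) \<in> E}" "{u\<in>V. (u, s) \<in> E}" k])
          (use outdeg[OF s] indeg[OF s] 1(2) True in auto)
    next
      case False
      \<comment> \<open>Since \<open>card V\<close> exceeds \<open>16 * m\<close>, absorption is
        called for only at lengths above \<open>10 * m\<close>, and so \<open>k - 1\<close> is still
        at least 3.\<close>
      then have "k > 3" using m \<open>m > 0\<close> by linarith
      then obtain xs where xs: "dicycle E xs" "set xs \<subseteq> V" "length xs = k - 1"
        using 1(1)[rule_format, of "k - 1"] 1(3) by fastforce
      have dist: "distinct xs" using xs(1) by (simp add: dicycle_def dipath_def)
      then have cxs: "card (set xs) = k - 1" using xs(3) by (simp add: distinct_card)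
      then have "set xs \<noteq> V" using 1(3) \<open>k > 3\<close> by auto
      then obtain w where w: "w \<in> V" "w \<notin> set xs" using xs(2) by blast
      have many: "10 * m \<le> card (X \<inter> set xs)" if "X \<subseteq> V" "16 * m \<le> card X" for X
      proof -
        have "card X \<le> card ((X \<inter> set xs) \<union> (V - set xs))"
          using that(1) assms(1) finite_subset by (intro card_mono) auto
        also have "\<dots> \<le> card (X \<inter> set xs) + card (V - set xs)" by (rule card_Un_le)
        also have "card (V - set xs) = card V - (k - 1)"
          using xs(2) cxs by (simp add: card_Diff_subset)
        finally show ?thesis using that(2) False \<open>k > 3\<close> by linarith
      qed
      obtain zs where zs: "dicycle E zs" "set zs = insert w (set xs)"
        by (rule dicycle_insert[OF assms(1,2) xs(1,2) w(2), of "{u\<in>V. (u, w) \<in> E}" "{u\<in>V. (w, u) \<in> E}"])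
          (use many outdeg[OF w(1)] indeg[OF w(1)] in auto)
      then have "distinct zs" by (simp add: dicycle_def dipath_def)
      then have "length zs = k"
        using zs(2) w(2) cxs \<open>k > 3\<close> by (metis Suc_pred' card_insert_disjoint distinct_card
            finite_set zero_less_numeral less_trans)
      then show ?thesis using zs xs(2) w(1) by (intro exI[of _ zs]) auto
    qed
  qed
qed

subsection \<open>Random digraphs are joined\<close>

text \<open>The quotient of the binomials is a product of \<open>M\<close> factors
  \<open>(N - f - i) / (N - i)\<close>, each at most \<open>1 - f / N\<close>; the induction peels
  off the factor with \<open>i = 0\<close>.\<close>

lemma binomial_diff_le:
  assumes "f \<le> N"
  shows "real ((N - f) choose M) \<le> (1 - real f / real N) ^ M * real (N choose M)"
  using assms
proof (induction M arbitrary: N)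
  case (Suc M)
  show ?case
  proof (cases "f = N")
    case True
    then show ?thesis by (cases "N = 0") auto
  next
    case False
    then obtain N' where N: "N = Suc N'" and f: "f \<le> N'" using Suc.prems by (cases N) auto
    have le: "0 \<le> 1 - real f / real N'" "1 - real f / real N' \<le> 1 - real f / real N"
      using f N by (cases "f = 0"; simp add: frac_le)+
    have "real (Suc M) * real ((N - f) choose Suc M) = real (Suc M * (Suc (N' - f) choose Suc M))"
      using f by (simp only: N Suc_diff_le of_nat_mult)
    also have "\<dots> = real (N - f) * real ((N' - f) choose M)"
      using f by (subst Suc_times_binomial) (simp only: N Suc_diff_le of_nat_mult)
    also have "\<dots> \<le> real (N - f) * ((1 - real f / real N') ^ M * real (N' choose M))"
      using Suc.IH[OF f] by (intro mult_left_mono) auto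
    also have "\<dots> \<le> real (N - f) * ((1 - real f / real N) ^ M * real (N' choose M))"
      using le by (intro mult_left_mono mult_right_mono power_mono) auto
    also have "real (N - f) = (1 - real f / real N) * real N"
      using N f by (simp add: of_nat_diff field_simps)
    also have "(1 - real f / real N) * real N * ((1 - real f / real N) ^ M * real (N' choose M))
        = (1 - real f / real N) ^ Suc M * real (Suc N' * (N' choose M))"
      by (simp only: N power_Suc of_nat_mult mult_ac)
    also have "\<dots> = real (Suc M) * ((1 - real f / real N) ^ Suc M * real (N choose Suc M))"
      unfolding N by (subst Suc_times_binomial[symmetric]) (simp only: of_nat_mult mult_ac)
    finally show ?thesis by (subst (asm) mult_le_cancel_left_pos) auto
  qed
qed simp

section \<open>Probability of missing all arcs between two large sets\<close>

lemma card_off_diagonal: "card (({1..n} \<times> {1..n}) - Id :: (nat \<times> nat) set) = n * (n - 1)"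
proof -
  have eq: "({1..n} \<times> {1..n}) - Id = ({1..n} \<times> {1..n}) - (\<lambda>i. (i, i)) ` {1..n}"
    by auto
  show ?thesis
    unfolding eq by (subst card_Diff_subset) (auto simp: card_image inj_on_def diff_mult_distrib2)
qed

lemma card_digraphs_avoiding:
  assumes "Z \<subseteq> ({1..n} \<times> {1..n}) - Id"
  shows "card {G \<in> digraphs_on n. card (parcs G) = M \<and> parcs G \<inter> Z = {}}
    = (n * (n - 1) - card Z) choose M"
proof -
  let ?P = "({1..n} \<times> {1..n}) - Id :: (nat \<times> nat) set"
  have finZ: "finite Z" using assms by (rule finite_subset) simp
  have "bij_betw parcs {G \<in> digraphs_on n. card (parcs G) = M \<and> parcs G \<inter> Z = {}}
      {F. F \<subseteq> ?P - Z \<and> card F = M}"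
    by (rule bij_betw_byWitness[where f' = "\<lambda>F. \<lparr>pverts = {1..n}, parcs = F\<rparr>"])
      (auto simp: digraphs_on_iff)
  then have "card {G \<in> digraphs_on n. card (parcs G) = M \<and> parcs G \<inter> Z = {}}
      = card {F. F \<subseteq> ?P - Z \<and> card F = M}"
    by (rule bij_betw_same_card)
  also have "\<dots> = card (?P - Z) choose M" by (rule n_subsets) simp
  also have "card (?P - Z) = n * (n - 1) - card Z"
    using card_Diff_subset[OF finZ assms] by (simp only: card_off_diagonal)
  finally show ?thesis .
qed

lemma prob_random_digraph_avoids_le:
  assumes "M \<le> n * (n - 1)" "Z \<subseteq> ({1..n} \<times> {1..n}) - Id"
  shows "measure_pmf.prob (random_digraph n M) {R. parcs R \<inter> Z = {}}
    \<le> (1 - real (card Z) / real (n * (n - 1))) ^ M"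
proof -
  let ?S = "{G \<in> digraphs_on n. card (parcs G) = M}"
  have cZ: "card Z \<le> n * (n - 1)"
    using card_mono[OF _ assms(2)] card_off_diagonal[of n] by simp
  have cS: "card ?S = (n * (n - 1)) choose M"
    using card_digraphs_avoiding[of "{}" n M] by simp
  have Int: "?S \<inter> {R. parcs R \<inter> Z = {}} = {G \<in> digraphs_on n. card (parcs G) = M \<and> parcs G \<inter> Z = {}}"
    by auto
  have "measure_pmf.prob (random_digraph n M) {R. parcs R \<inter> Z = {}}
      = real ((n * (n - 1) - card Z) choose M) / real ((n * (n - 1)) choose M)"
    unfolding random_digraph_def
    using digraphs_on_card_nonempty[OF assms(1)] finite_digraphs_on
    by (subst measure_pmf_of_set) (simp_all add: Int card_digraphs_avoiding[OF assms(2)] cS)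
  also have "\<dots> \<le> (1 - real (card Z) / real (n * (n - 1))) ^ M"
    using binomial_diff_le[OF cZ, of M] assms(1)
    by (simp add: pos_divide_le_eq zero_less_binomial)
  finally show ?thesis .
qed

text \<open>Union bound over at most \<open>2 ^ n * 2 ^ n\<close> pairs of sets. For each pair,
  \<open>\<beta>\<close> bounds from below the fraction of all possible arcs that lead from
  \<open>A\<close> to \<open>B\<close>.\<close>

lemma prob_random_digraph_not_joined_le:
  assumes M: "M \<le> n * (n - 1)" and \<beta>: "0 \<le> \<beta>" "\<beta> * real (n * (n - 1)) \<le> real (m * (m - 1))"
  shows "measure_pmf.prob (random_digraph n M) {R. \<not> joined (parcs R) {1..n} m}
    \<le> 4 ^ n * exp (- \<beta> * real M)"
proof -
  define I where "I = {A. A \<subseteq> {1..n} \<and> m \<le> card A}"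
  have finI: "finite I" by (simp add: I_def)
  have cI: "card I \<le> 2 ^ n"
    using card_mono[of "Pow {1..n}" I] by (auto simp: I_def card_Pow)
  let ?Z = "\<lambda>(A, B). A \<times> B - Id :: (nat \<times> nat) set"
  let ?prob = "measure_pmf.prob (random_digraph n M)"
  have "{R :: nat pair_pre_digraph. \<not> joined (parcs R) {1..n} m} \<subseteq> (\<Union>AB\<in>I \<times> I. {R. parcs R \<inter> ?Z AB = {}})"
  proof
    fix R :: "nat pair_pre_digraph"
    assume "R \<in> {R. \<not> joined (parcs R) {1..n} m}"
    then obtain A B where "A \<subseteq> {1..n}" "B \<subseteq> {1..n}" "m \<le> card A" "m \<le> card B"
      and AB: "\<forall>a\<in>A. \<forall>b\<in>B. (a, b) \<notin> parcs R"
      unfolding joined_def by blast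
    then have "(A, B) \<in> I \<times> I" by (simp add: I_def)
    moreover have "parcs R \<inter> ?Z (A, B) = {}" using AB by auto
    ultimately show "R \<in> (\<Union>AB\<in>I \<times> I. {R. parcs R \<inter> ?Z AB = {}})" by blast
  qed
  then have "?prob {R. \<not> joined (parcs R) {1..n} m}
      \<le> ?prob (\<Union>AB\<in>I \<times> I. {R. parcs R \<inter> ?Z AB = {}})"
    by (intro measure_pmf.finite_measure_mono) simp_all
  also have "\<dots> \<le> (\<Sum>AB\<in>I \<times> I. ?prob {R. parcs R \<inter> ?Z AB = {}})"
    using finI by (intro measure_pmf.finite_measure_subadditive_finite) auto
  also have "\<dots> \<le> (\<Sum>AB\<in>I \<times> I. exp (- \<beta> * real M))"
  proof (rule sum_mono)
    fix AB assume "AB \<in> I \<times> I"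
    then obtain A B where AB: "AB = (A, B)" "A \<in> I" "B \<in> I" by auto
    have fin: "finite A" "finite B" using AB finite_subset by (auto simp: I_def)
    have sub: "?Z AB \<subseteq> ({1..n} \<times> {1..n}) - Id" using AB by (auto simp: I_def)
    \<comment> \<open>A vertex of \<open>A\<close> may itself lie in \<open>B\<close>, and the loop
      there is not a possible arc; hence \<open>m - 1\<close>.\<close>
    have "m * (m - 1) \<le> card A * (card B - 1)" using AB by (intro mult_le_mono) (auto simp: I_def)
    also have "\<dots> = (\<Sum>a\<in>A. card B - 1)" by simp
    also have "\<dots> \<le> (\<Sum>a\<in>A. card (B - {a}))"
      using diff_card_le_card_Diff[of "{_}" B] by (intro sum_mono) auto
    also have "\<dots> = card (SIGMA a:A. B - {a})" using fin by simp
    also have "(SIGMA a:A. B - {a}) = ?Z AB" using AB by auto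
    finally have "real (m * (m - 1)) \<le> real (card (?Z AB))" by (rule of_nat_mono)
    then have *: "\<beta> * real (n * (n - 1)) \<le> real (card (?Z AB))" using \<beta> by linarith
    have cZ: "card (?Z AB) \<le> n * (n - 1)"
      using card_mono[OF _ sub] card_off_diagonal[of n] by simp
    show "?prob {R. parcs R \<inter> ?Z AB = {}} \<le> exp (- \<beta> * real M)"
    \<comment> \<open>Without possible arcs the density is a division by zero, but then
      \<open>M = 0\<close> and the claimed bound is 1.\<close>
    proof (cases "n * (n - 1) = 0")
      case True
      then have "M = 0" using M by linarith
      then show ?thesis by simp
    next
      case False
      let ?x = "real (card (?Z AB)) / real (n * (n - 1))"
      have x: "\<beta> \<le> ?x" "?x \<le> 1"
        using * cZ False by (simp_all add: pos_le_divide_eq del: of_nat_mult)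
      have "?prob {R. parcs R \<inter> ?Z AB = {}} \<le> (1 - ?x) ^ M"
        by (rule prob_random_digraph_avoids_le[OF M sub])
      also have "\<dots> \<le> exp (- \<beta>) ^ M"
        using x exp_ge_add_one_self[of "- \<beta>"] by (intro power_mono) auto
      also have "\<dots> = exp (- \<beta> * real M)"
        by (simp add: exp_of_nat_mult[symmetric] mult.commute)
      finally show ?thesis .
    qed
  qed
  also have "\<dots> = real (card I * card I) * exp (- \<beta> * real M)"
    by (simp add: card_cartesian_product)
  also have "\<dots> \<le> real (2 ^ n * 2 ^ n) * exp (- \<beta> * real M)"
    using cI by (intro mult_right_mono) (auto simp del: of_nat_mult intro!: of_nat_mono mult_le_mono)
  also have "2 ^ n * 2 ^ n = (4 :: nat) ^ n" by (simp flip: power_mult_distrib)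
  finally show ?thesis by simp
qed

lemma random_digraph_joined_tendsto:
  assumes "\<gamma> > 0" "\<And>n. \<gamma> * real n - 1 \<le> real (m n)" and c: "c = 8 / \<gamma>\<^sup>2"
  shows "(\<lambda>n. measure_pmf.prob (random_digraph n (nat \<lfloor>c * real n\<rfloor>))
    {R. joined (parcs R) {1..n} (m n)}) \<longlonglongrightarrow> 1"
proof -
  \<comment> \<open>Halving \<open>\<gamma>\<close> absorbs the rounding in \<open>m n\<close> and
    the factor \<open>m n - 1\<close>, once \<open>\<gamma> * real n\<close> is at least 4. The
    constant \<open>c\<close> is chosen to make \<open>\<beta> * c = 2\<close>.\<close>
  define \<beta> where "\<beta> = (\<gamma> / 2)\<^sup>2"
  have \<beta>: "\<beta> > 0" "\<beta> * c = 2" using assms by (auto simp: \<beta>_def power2_eq_square)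
  let ?prob = "\<lambda>n. measure_pmf.prob (random_digraph n (nat \<lfloor>c * real n\<rfloor>))"
  \<comment> \<open>The exponent is about \<open>- 2 * n\<close>, and \<open>exp 2 > 4\<close> beats
    the number of pairs; \<open>exp \<beta>\<close> pays for rounding \<open>c * real n\<close>
    down.\<close>
  have lim: "(\<lambda>n. exp \<beta> * (4 * exp (- 2)) ^ n) \<longlonglongrightarrow> 0"
  proof -
    have "(4 :: real) < exp 2" using exp_lower_Taylor_quadratic[of 2] by simp
    then have "4 * exp (- 2 :: real) < 1" by (simp add: exp_minus field_simps)
    then show ?thesis using tendsto_mult_right[OF LIMSEQ_power_zero, of "4 * exp (- 2 :: real)" "exp \<beta>"] by simp
  qed
  have ev: "\<forall>\<^sub>F n in sequentially. ?prob n {R. \<not> joined (parcs R) {1..n} (m n)}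
      \<le> exp \<beta> * (4 * exp (- 2)) ^ n"
    using eventually_ge_at_top[of "nat \<lceil>4 / \<gamma>\<rceil>"] eventually_ge_at_top[of "nat \<lceil>c\<rceil> + 1"]
  proof eventually_elim
    case (elim n)
    have "4 \<le> \<gamma> * real n"
      using elim(1) assms(1) by (simp add: nat_le_iff ceiling_le_iff pos_divide_le_eq mult.commute)
    then have m1: "\<gamma> / 2 * real n \<le> real (m n) - 1" using assms(2)[of n] by linarith
    moreover have "0 \<le> \<gamma> / 2 * real n" using assms(1) by simp
    ultimately have m: "1 \<le> m n" "\<gamma> / 2 * real n \<le> real (m n)" by linarith+
    have "\<beta> * real (n * (n - 1)) \<le> (\<gamma> / 2 * real n) * (\<gamma> / 2 * real n)"
    proof -
      have "real (n * (n - 1)) \<le> real (n * n)" by (intro of_nat_mono mult_le_mono) auto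
      then have "\<beta> * real (n * (n - 1)) \<le> \<beta> * real (n * n)" using \<beta> by (intro mult_left_mono) auto
      then show ?thesis by (simp add: \<beta>_def power2_eq_square mult_ac)
    qed
    also have "\<dots> \<le> real (m n) * (real (m n) - 1)"
      using m m1 \<open>0 \<le> \<gamma> / 2 * real n\<close> by (intro mult_mono) auto
    also have "\<dots> = real (m n * (m n - 1))" using m by (simp add: of_nat_diff)
    finally have 1: "\<beta> * real (n * (n - 1)) \<le> real (m n * (m n - 1))" .
    have "c \<le> real (n - 1)" using elim(2) by linarith
    then have "c * real n \<le> real (n - 1) * real n" by (intro mult_right_mono) auto
    then have "c * real n \<le> real (n * (n - 1))" by (simp only: of_nat_mult mult.commute)
    then have 2: "nat \<lfloor>c * real n\<rfloor> \<le> n * (n - 1)" by linarith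
    have "\<beta> * (c * real n - 1) \<le> \<beta> * real (nat \<lfloor>c * real n\<rfloor>)"
      using \<beta> by (intro mult_left_mono) linarith+
    then have 3: "- \<beta> * real (nat \<lfloor>c * real n\<rfloor>) \<le> \<beta> + real n * (- 2)"
      using \<beta>(2) by (simp add: right_diff_distrib mult.assoc[symmetric])
    have "?prob n {R. \<not> joined (parcs R) {1..n} (m n)} \<le> 4 ^ n * exp (- \<beta> * real (nat \<lfloor>c * real n\<rfloor>))"
      using prob_random_digraph_not_joined_le[OF 2 _ 1] \<beta> by simp
    also have "\<dots> \<le> 4 ^ n * exp (\<beta> + real n * (- 2))"
      using 3 by (intro mult_left_mono) (simp_all only: exp_le_cancel_iff, simp)
    also have "\<dots> = exp \<beta> * (4 * exp (- 2)) ^ n"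
      by (simp only: exp_add exp_of_nat_mult power_mult_distrib mult_ac)
    finally show ?case .
  qed
  have "(\<lambda>n. ?prob n {R. \<not> joined (parcs R) {1..n} (m n)}) \<longlonglongrightarrow> 0"
    by (rule tendsto_sandwich[OF _ ev tendsto_const lim]) (simp add: measure_nonneg)
  then have "(\<lambda>n. 1 - ?prob n {R. \<not> joined (parcs R) {1..n} (m n)}) \<longlonglongrightarrow> 1 - 0"
    by (intro tendsto_intros)
  moreover have "?prob n {R. joined (parcs R) {1..n} (m n)}
      = 1 - ?prob n {R. \<not> joined (parcs R) {1..n} (m n)}" for n
    using measure_pmf.prob_compl[of "{R. \<not> joined (parcs R) {1..n} (m n)}" "random_digraph n (nat \<lfloor>c * real n\<rfloor>)"]
    by (simp add: Compl_eq_Diff_UNIV[symmetric] Collect_neg_eq[symmetric])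
  ultimately show ?thesis by simp
qed

subsection \<open>Pancyclicity\<close>

text \<open>\<open>pre_digraph.cycle\<close> takes a list of arcs; pairing the vertex list with its
  rotation by one produces the arcs of the cycle, including the closing one.\<close>

lemma cycle_zip_dicycle:
  fixes G :: "('a, 'a \<times> 'a) pre_digraph"
  assumes G: "tail G = fst" "head G = snd"
    and cyc: "dicycle (arcs G) xs" "set xs \<subseteq> verts G"
  shows "pre_digraph.cycle G (zip xs (tl xs @ [hd xs]))"
proof -
  have xs: "xs \<noteq> []" "distinct xs" "set xs \<subseteq> verts G" "successively (\<lambda>x y. (x, y) \<in> arcs G) xs"
      "(last xs, hd xs) \<in> arcs G"
    using cyc by (auto simp: dicycle_def dipath_def)
  \<comment> \<open>The end vertex \<open>v\<close> stays arbitrary, because the induction passes to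
    tails of the list while the end remains \<open>hd xs\<close>.\<close>
  have cas: "pre_digraph.cas G (hd ys) (zip ys (tl ys @ [v])) v" if "ys \<noteq> []" for ys v
    using that
  proof (induction ys)
    case (Cons y ys)
    then show ?case by (cases ys) (auto simp: pre_digraph.cas.simps G)
  qed simp
  have arcs: "set (zip ys (tl ys @ [v])) \<subseteq> arcs G"
    if "ys \<noteq> []" "successively (\<lambda>x y. (x, y) \<in> arcs G) ys" "(last ys, v) \<in> arcs G" for ys v
    using that
  proof (induction ys)
    case (Cons y ys)
    then show ?case by (cases ys) auto
  qed simp
  have "pre_digraph.awalk G (hd xs) (zip xs (tl xs @ [hd xs])) (hd xs)"
    unfolding pre_digraph.awalk_def using cas arcs xs by auto
  moreover have "pre_digraph.awalk_verts G (hd xs) (zip xs (tl xs @ [hd xs])) = xs @ [hd xs]"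
    using xs(1) by (subst pre_digraph.awalk_verts_conv) (auto simp: G map_fst_zip_take last_zip)
  ultimately show ?thesis
    unfolding pre_digraph.cycle_def using xs by (intro exI[of _ "hd xs"]) (cases xs, auto)
qed

lemma degree_with_proj:
  assumes "G \<in> digraphs_on n"
  shows "out_degree (with_proj G) v = card {u\<in>{1..n}. (v, u) \<in> parcs G}"
    and "in_degree (with_proj G) v = card {u\<in>{1..n}. (u, v) \<in> parcs G}"
proof -
  have sub: "parcs G \<subseteq> {1..n} \<times> {1..n}" using assms by (auto simp: digraphs_on_iff)
  have "out_arcs (with_proj G) v = (\<lambda>u. (v, u)) ` {u\<in>{1..n}. (v, u) \<in> parcs G}"
    using sub by (auto simp: out_arcs_def)
  then show "out_degree (with_proj G) v = card {u\<in>{1..n}. (v, u) \<in> parcs G}"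
    by (simp add: out_degree_def card_image inj_on_def)
  have "in_arcs (with_proj G) v = (\<lambda>u. (u, v)) ` {u\<in>{1..n}. (u, v) \<in> parcs G}"
    using sub by (auto simp: in_arcs_def)
  then show "in_degree (with_proj G) v = card {u\<in>{1..n}. (u, v) \<in> parcs G}"
    by (simp add: in_degree_def card_image inj_on_def)
qed

text \<open>The degrees come from \<open>D\<close> and joinedness from \<open>R\<close>; both
  survive the addition of arcs.\<close>

lemma pancyclic_union_joined:
  assumes D: "D \<in> digraphs_on n" and R: "R \<in> digraphs_on n" "joined (parcs R) {1..n} m"
    and deg: "\<And>v. v \<in> {1..n} \<Longrightarrow> 16 * m \<le> in_degree (with_proj D) v"
      "\<And>v. v \<in> {1..n} \<Longrightarrow> 16 * m \<le> out_degree (with_proj D) v"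
  shows "pancyclic (union (with_proj D) (with_proj R))"
proof -
  let ?G = "union (with_proj D) (with_proj R)"
  let ?E = "parcs D \<union> parcs R"
  have G: "verts ?G = {1..n}" "arcs ?G = ?E" "tail ?G = fst" "head ?G = snd"
    using D R by (auto simp: union_def digraphs_on_iff)
  have "joined ?E {1..n} m" using joined_mono[OF R(2)] by simp
  moreover have "irrefl ?E" using D R(1) by (auto simp: digraphs_on_iff irrefl_def)
  moreover have "16 * m \<le> card {u\<in>{1..n}. (v, u) \<in> ?E}" if "v \<in> {1..n}" for v
    using deg(2)[OF that] unfolding degree_with_proj(1)[OF D]
    by (rule order_trans) (auto intro: card_mono)
  moreover have "16 * m \<le> card {u\<in>{1..n}. (u, v) \<in> ?E}" if "v \<in> {1..n}" for v
    using deg(1)[OF that] unfolding degree_with_proj(2)[OF D]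
    by (rule order_trans) (auto intro: card_mono)
  ultimately have all: "\<exists>xs. dicycle ?E xs \<and> set xs \<subseteq> {1..n} \<and> length xs = k" if "k \<in> {3..n}" for k
    using that by (intro dicycle_all_lengths[of _ _ m]) auto
  have "\<exists>p. pre_digraph.cycle ?G p \<and> length p = k" if k: "k \<in> {3..n}" for k
  proof -
    obtain xs where xs: "dicycle ?E xs" "set xs \<subseteq> {1..n}" "length xs = k"
      using all[OF k] by blast
    have "pre_digraph.cycle ?G (zip xs (tl xs @ [hd xs]))"
      by (rule cycle_zip_dicycle) (simp_all only: G xs)
    moreover have "length (zip xs (tl xs @ [hd xs])) = k" using xs(3) k by auto
    ultimately show ?thesis by blast
  qed
  then show ?thesis unfolding pancyclic_def G(1) by simp
qed

theorem theorem3: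
  fixes \<alpha> :: real
  assumes "\<alpha> > 0"
  shows "\<exists>c::real. c > 0 \<and>
    (\<forall>D :: nat \<Rightarrow> nat pair_pre_digraph.
      (\<forall>n. D n \<in> digraphs_on n) \<longrightarrow>
      (\<forall>\<^sub>F n in sequentially. \<forall>v\<in>{1..n}.
         real (in_degree (with_proj (D n)) v) \<ge> \<alpha> * real n \<and>
         real (out_degree (with_proj (D n)) v) \<ge> \<alpha> * real n) \<longrightarrow>
      (\<lambda>n. measure_pmf.prob (random_digraph n (nat \<lfloor>c * real n\<rfloor>))
             {R. pancyclic (union (with_proj (D n)) (with_proj R))})
        \<longlonglongrightarrow> 1)"
proof -
  \<comment> \<open>With this choice \<open>16 * m n\<close> is at most
    \<open>\<alpha> * real n\<close>, as the degree condition requires.\<close>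
  define \<gamma> where "\<gamma> = \<alpha> / 16"
  define c where "c = 8 / \<gamma>\<^sup>2"
  define m where "m n = nat \<lfloor>\<gamma> * real n\<rfloor>" for n
  have \<gamma>: "\<gamma> > 0" using assms by (simp add: \<gamma>_def)
  let ?p = "\<lambda>n. random_digraph n (nat \<lfloor>c * real n\<rfloor>)"
  have lim: "(\<lambda>n. measure_pmf.prob (?p n) {R. joined (parcs R) {1..n} (m n)}) \<longlonglongrightarrow> 1"
    by (rule random_digraph_joined_tendsto[OF \<gamma> _ c_def]) (simp add: m_def, linarith)
  have "(\<lambda>n. measure_pmf.prob (?p n) {R. pancyclic (union (with_proj (D n)) (with_proj R))})
      \<longlonglongrightarrow> 1"
    if D: "\<forall>n. D n \<in> digraphs_on n" and deg: "\<forall>\<^sub>F n in sequentially. \<forall>v\<in>{1..n}.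
         real (in_degree (with_proj (D n)) v) \<ge> \<alpha> * real n \<and>
         real (out_degree (with_proj (D n)) v) \<ge> \<alpha> * real n" for D
  proof (rule tendsto_sandwich[OF _ _ lim tendsto_const])
    \<comment> \<open>Only when this many arcs fit on \<open>n\<close> vertices is the distribution
      known to be supported on digraphs.\<close>
    have "\<forall>\<^sub>F n in sequentially. c * real n \<le> real n * (real n - 1)" by real_asymp
    with deg show "\<forall>\<^sub>F n in sequentially. measure_pmf.prob (?p n) {R. joined (parcs R) {1..n} (m n)}
        \<le> measure_pmf.prob (?p n) {R. pancyclic (union (with_proj (D n)) (with_proj R))}"
    proof eventually_elim
      case (elim n)
      have "c * real n \<le> real (n * (n - 1))" using elim(2) by (cases n) (auto simp: algebra_simps)
      then have "nat \<lfloor>c * real n\<rfloor> \<le> n * (n - 1)" by linarith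
      then have supp: "R \<in> digraphs_on n" if "R \<in> set_pmf (?p n)" for R
        using that digraphs_on_card_nonempty[of "nat \<lfloor>c * real n\<rfloor>" n] finite_digraphs_on[of n]
        by (simp add: random_digraph_def)
      have "real (16 * m n) \<le> \<alpha> * real n"
      proof -
        have "0 \<le> \<gamma> * real n" using \<gamma> by simp
        then have "real (m n) \<le> \<gamma> * real n" unfolding m_def by linarith
        then show ?thesis by (simp add: \<gamma>_def)
      qed
      then have deg': "16 * m n \<le> in_degree (with_proj (D n)) v"
        "16 * m n \<le> out_degree (with_proj (D n)) v" if "v \<in> {1..n}" for v
        using elim(1) that by (meson of_nat_le_iff order_trans)+
      have "AE R in measure_pmf (?p n). R \<in> {R. joined (parcs R) {1..n} (m n)} \<longrightarrow>
          R \<in> {R. pancyclic (union (with_proj (D n)) (with_proj R))}"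
        using pancyclic_union_joined[OF D[rule_format] supp _ deg'] by (auto simp: AE_measure_pmf_iff)
      then show ?case by (intro measure_pmf.finite_measure_mono_AE) auto
    qed
  qed (simp add: measure_pmf.prob_le_1)
  moreover have "c > 0" using \<gamma> by (simp add: c_def)
  ultimately show ?thesis by blast
qed

end
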